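(* For every $c \in \mathbb{N}$, there exists a 1-planar graph $G$ with cop number $c(G) \geq c$.
   Context: A graph is 1-planar if it can be drawn in the plane so that each edge is crossed at most once (drawings are simple: adjacent edges do not cross and two edges cross at most once). Cops and Robbers: on a graph $G$, the cop player first places a set of cops on vertices, then the robber player places a robber on a vertex; then players alternate turns, the cop player moving any subset of cops each along an edge to an adjacent vertex (or leaving them in place), and the robber moving along an edge to an adjacent vertex or staying. Both players have full information. The cops win if at some point a cop and the robber occupy the same vertex. The cop number $c(G)$ is the minimum number of cops that guarantees the cops win against any robber strategy. *)

theory Defs
  imports "Graph_Theory.Graph_Theory" "HOL-Analysis.Analysis"
begin

text \<open>
  A finite simple undirected graph is a \<^locale>\<open>pair_graph\<close>: a symmetric, loop-free digraph
  without parallel arcs. An undirected edge is the two-element set of its ends, so it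
  stands for both arcs \<open>(u, v)\<close> and \<open>(v, u)\<close>.
\<close>

definition uedges :: "'a pair_pre_digraph \<Rightarrow> 'a set set" where
  "uedges G = {{u, v} | u v. (u, v) \<in> parcs G}"


section \<open>Drawings in the plane\<close>

text \<open>
  A drawing is given by the positions \<open>pos v\<close> of the vertices and a curve \<open>\<gamma> e\<close> for each
  edge \<open>e\<close>; the plane is \<^typ>\<open>complex\<close>.
\<close>

definition crossings ::
  "('a \<Rightarrow> complex) \<Rightarrow> ('a set \<Rightarrow> real \<Rightarrow> complex) \<Rightarrow> 'a set \<Rightarrow> 'a set \<Rightarrow> complex set" where
  "crossings pos \<gamma> e f =
     (path_image (\<gamma> e) - pos ` e) \<inter> (path_image (\<gamma> f) - pos ` f)"

text \<open>
  A proper crossing, as opposed to a touching: near \<open>p\<close> the two curves look like the two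
  coordinate axes near the origin, up to a homeomorphism.
\<close>

definition cross_properly_at :: "complex set \<Rightarrow> complex set \<Rightarrow> complex \<Rightarrow> bool" where
  "cross_properly_at A B p \<longleftrightarrow>
     (\<exists>U h k. open U \<and> p \<in> U \<and> homeomorphism U (ball 0 1) h k \<and> h p = 0 \<and>
        h ` (A \<inter> U) = {z \<in> ball 0 1. Im z = 0} \<and>
        h ` (B \<inter> U) = {z \<in> ball 0 1. Re z = 0})"

definition drawing ::
  "'a pair_pre_digraph \<Rightarrow> ('a \<Rightarrow> complex) \<Rightarrow> ('a set \<Rightarrow> real \<Rightarrow> complex) \<Rightarrow> bool" where
  "drawing G pos \<gamma> \<longleftrightarrow>
     inj_on pos (pverts G) \<and>
     (\<forall>e \<in> uedges G.
        arc (\<gamma> e) \<and> {pathstart (\<gamma> e), pathfinish (\<gamma> e)} = pos ` e \<and>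
        path_image (\<gamma> e) \<inter> pos ` pverts G = pos ` e) \<and>
     (\<forall>e \<in> uedges G. \<forall>f \<in> uedges G. e \<noteq> f \<longrightarrow>
        (\<forall>p \<in> crossings pos \<gamma> e f.
           cross_properly_at (path_image (\<gamma> e)) (path_image (\<gamma> f)) p))"

definition simple_drawing ::
  "'a pair_pre_digraph \<Rightarrow> ('a \<Rightarrow> complex) \<Rightarrow> ('a set \<Rightarrow> real \<Rightarrow> complex) \<Rightarrow> bool" where
  "simple_drawing G pos \<gamma> \<longleftrightarrow>
     drawing G pos \<gamma> \<and>
     (\<forall>e \<in> uedges G. \<forall>f \<in> uedges G. e \<noteq> f \<longrightarrow>
        (e \<inter> f \<noteq> {} \<longrightarrow> crossings pos \<gamma> e f = {}) \<and>
        finite (crossings pos \<gamma> e f) \<and> card (crossings pos \<gamma> e f) \<le> 1)"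

text \<open>
  Crossings of \<open>e\<close> are counted as pairs of another edge and a point, so three edges through
  one point give each of them two crossings.
\<close>

definition edge_crossings ::
  "'a pair_pre_digraph \<Rightarrow> ('a \<Rightarrow> complex) \<Rightarrow> ('a set \<Rightarrow> real \<Rightarrow> complex) \<Rightarrow>
   'a set \<Rightarrow> ('a set \<times> complex) set" where
  "edge_crossings G pos \<gamma> e =
     {(f, p). f \<in> uedges G \<and> f \<noteq> e \<and> p \<in> crossings pos \<gamma> e f}"

definition one_planar :: "'a pair_pre_digraph \<Rightarrow> bool" where
  "one_planar G \<longleftrightarrow>
     (\<exists>pos \<gamma>. simple_drawing G pos \<gamma> \<and>
        (\<forall>e \<in> uedges G.
           finite (edge_crossings G pos \<gamma> e) \<and> card (edge_crossings G pos \<gamma> e) \<le> 1))"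


section \<open>Cops and Robbers\<close>

definition game_step :: "'a pair_pre_digraph \<Rightarrow> 'a \<Rightarrow> 'a \<Rightarrow> bool" where
  "game_step G u v \<longleftrightarrow> u = v \<or> (u, v) \<in> parcs G"

text \<open>
  The order of play is \<open>C 0, r 0, C 1, r 1, \<dots>\<close>, where \<open>C n i\<close> is the position of cop \<open>i < k\<close>
  and \<open>r n\<close> that of the robber after their \<open>n\<close>-th moves; index \<open>0\<close> is the initial placement.
  Several cops may share a vertex.
\<close>

definition robber_play :: "'a pair_pre_digraph \<Rightarrow> (nat \<Rightarrow> 'a) \<Rightarrow> bool" where
  "robber_play G r \<longleftrightarrow> r 0 \<in> pverts G \<and> (\<forall>n. game_step G (r n) (r (Suc n)))"

definition cop_play :: "'a pair_pre_digraph \<Rightarrow> nat \<Rightarrow> (nat \<Rightarrow> nat \<Rightarrow> 'a) \<Rightarrow> bool" where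
  "cop_play G k C \<longleftrightarrow>
     (\<forall>i<k. C 0 i \<in> pverts G) \<and> (\<forall>n. \<forall>i<k. game_step G (C n i) (C (Suc n) i))"

text \<open>The two disjuncts: capture after a robber move, and capture after the next cop move.\<close>

definition captured :: "nat \<Rightarrow> (nat \<Rightarrow> nat \<Rightarrow> 'a) \<Rightarrow> (nat \<Rightarrow> 'a) \<Rightarrow> bool" where
  "captured k C r \<longleftrightarrow> (\<exists>n. \<exists>i<k. C n i = r n \<or> C (Suc n) i = r n)"

text \<open>
  A cop strategy \<open>\<sigma>\<close> maps the list of robber positions seen so far to the next cop
  positions; the cops' own past positions are determined by \<open>\<sigma>\<close> and that list. It wins if
  every play of the robber against it, hence every robber strategy, leads to a capture.
\<close>

definition cop_response :: "('a list \<Rightarrow> nat \<Rightarrow> 'a) \<Rightarrow> (nat \<Rightarrow> 'a) \<Rightarrow> nat \<Rightarrow> nat \<Rightarrow> 'a" where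
  "cop_response \<sigma> r n = \<sigma> (map r [0..<n])"

definition cops_win :: "'a pair_pre_digraph \<Rightarrow> nat \<Rightarrow> bool" where
  "cops_win G k \<longleftrightarrow>
     (\<exists>\<sigma>. \<forall>r. robber_play G r \<longrightarrow>
        cop_play G k (cop_response \<sigma> r) \<and> captured k (cop_response \<sigma> r) r)"

definition cop_number :: "'a pair_pre_digraph \<Rightarrow> nat" where
  "cop_number G = (LEAST k. cops_win G k)"

text \<open>On a finite graph the minimum is attained, as a cop on every vertex wins.\<close>

lemma cops_win_card:
  assumes "finite (pverts G)"
  shows "cops_win G (card (pverts G))"
proof -
  obtain h where h: "bij_betw h {0..<card (pverts G)} (pverts G)"
    using ex_bij_betw_nat_finite[OF assms] by blast
  have "cop_play G (card (pverts G)) (cop_response (\<lambda>_. h) r)" for r :: "nat \<Rightarrow> 'a"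
    using bij_betwE[OF h] by (auto simp: cop_play_def cop_response_def game_step_def)
  moreover have "captured (card (pverts G)) (cop_response (\<lambda>_. h) r) r"
    if play: "robber_play G r" for r
  proof -
    obtain i where "i < card (pverts G)" "h i = r 0"
      using play h by (force simp: robber_play_def bij_betw_def)
    then show ?thesis
      unfolding captured_def cop_response_def by metis
  qed
  ultimately show ?thesis
    unfolding cops_win_def by blast
qed

end

theory Submission
  imports Defs
begin

text \<open>
  Take a bipartite graph without 4-cycles and of large minimum degree, here the incidences of
  points and lines \<open>y + m * x + b = 0\<close>, and replace every edge by a path of the same length \<open>L\<close>.
  For \<open>L\<close> large, a straight-line drawing without three concurrent edges becomes 1-planar, as the
  subdivision vertices separate the crossings on each edge.

  The robber stops only at branch vertices. A cop elsewhere is within distance \<open>L\<close> of at most one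
  neighbouring branch vertex, as there are no 4-cycles. With fewer cops than the minimum degree,
  the robber thus always has a neighbouring branch vertex that he reaches before every cop.
\<close>

section \<open>Straight-line drawings\<close>

text \<open>Connectedness is proved along with the rest because without it \<open>c\<close> isolated
  vertices would do. The drawing faces an apparent circularity: the paths must be long enough to
  separate the crossings, but the crossings move when \<open>L\<close> changes. Therefore the whole
  picture scales with \<open>L\<close>. The relative abscissa \<open>x / L\<close> of a crossing
  then depends only on the ends of the two edges, so these ratios lie in a finite set that is known
  before \<open>L\<close> is chosen, and a large \<open>L\<close> pulls them at least one unit
  apart. Subdivision vertices sit at integer abscissae, so two pieces can cross only inside a common
  vertical strip of width one. Equal path lengths also keep the pursuit simple: every neighbouring
  branch vertex is exactly \<open>L\<close> steps from the robber's, so a single threshold decides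
  whether a cop spoils it.\<close>

lemma sqrt2_irrational: "sqrt 2 \<notin> \<rat>"
proof
  assume "sqrt 2 \<in> \<rat>"
  then obtain m n :: nat where n: "n \<noteq> 0" and mn: "\<bar>sqrt 2\<bar> = m / n" "coprime m n"
    by (rule Rats_abs_nat_div_natE)
  have "sqrt 2 = real m / real n"
    using mn(1) by (metis abs_of_nonneg real_sqrt_ge_zero zero_le_numeral)
  then have "real m = sqrt 2 * real n"
    using n by (metis nonzero_eq_divide_eq of_nat_eq_0_iff)
  then have "(real m)\<^sup>2 = 2 * (real n)\<^sup>2"
    by (simp add: power_mult_distrib)
  then have "real (m\<^sup>2) = real (2 * n\<^sup>2)"
    by simp
  then have eq: "m\<^sup>2 = 2 * n\<^sup>2"
    by (simp only: of_nat_eq_iff)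
  then have "even (m\<^sup>2)"
    by simp
  then have "even m"
    by simp
  then obtain l where "m = 2 * l" by blast
  with eq have "n\<^sup>2 = 2 * l\<^sup>2" by (simp add: power2_eq_square)
  then have "even (n\<^sup>2)"
    by simp
  then have "even n"
    by simp
  with \<open>even m\<close> mn(2) show False
    using coprime_common_divisor[of m n 2] by simp
qed

lemma finite_card_le_1I:
  assumes "\<And>x y. x \<in> A \<Longrightarrow> y \<in> A \<Longrightarrow> x = y"
  shows "finite A \<and> card A \<le> 1"
proof (cases "A = {}")
  case False
  then obtain x where "A = {x}" using assms by blast
  then show ?thesis by simp
qed simp

text \<open>Cramer's rule with determinant \<open>\<Delta>\<close>: \<open>h\<close> reads off the
  coordinates of \<open>z - p\<close> in the basis \<open>d\<close>, \<open>e\<close>, divided by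
  \<open>r\<close>, and \<open>k\<close> is the affine map that undoes this.\<close>

lemma linear_coordinates_inverse:
  fixes p d e :: complex and r :: real
  defines "\<Delta> \<equiv> Re d * Im e - Im d * Re e"
  defines "h \<equiv> \<lambda>z. Complex ((Re (z - p) * Im e - Im (z - p) * Re e) / (\<Delta> * r))
                          ((Re d * Im (z - p) - Im d * Re (z - p)) / (\<Delta> * r))"
  defines "k \<equiv> \<lambda>w. p + of_real (r * Re w) * d + of_real (r * Im w) * e"
  assumes "\<Delta> \<noteq> 0" and "r > 0"
  shows "h (k w) = w" and "k (h z) = z" and "continuous_on S h" and "continuous_on S k"
proof -
  have r: "r \<noteq> 0" using assms by simp
  show hk: "h (k w) = w"
  proof (rule complex_eqI)
    have "Re (h (k w)) = (r * Re w * \<Delta>) / (\<Delta> * r)"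
      by (simp add: h_def k_def \<Delta>_def algebra_simps)
    then show "Re (h (k w)) = Re w" using r assms(4) by simp
    have "Im (h (k w)) = (r * Im w * \<Delta>) / (\<Delta> * r)"
      by (simp add: h_def k_def \<Delta>_def algebra_simps)
    then show "Im (h (k w)) = Im w" using r assms(4) by simp
  qed
  let ?u = "Re (z - p) * Im e - Im (z - p) * Re e" and ?v = "Re d * Im (z - p) - Im d * Re (z - p)"
  have 1: "r * Re (h z) = ?u / \<Delta>" "r * Im (h z) = ?v / \<Delta>"
    using r by (simp_all add: h_def)
  have 2: "?u / \<Delta> * Re d + ?v / \<Delta> * Re e = Re (z - p)"
  proof -
    have "?u / \<Delta> * Re d + ?v / \<Delta> * Re e = (\<Delta> * Re (z - p)) / \<Delta>"
      unfolding times_divide_eq_left add_divide_distrib[symmetric]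
      by (rule arg_cong[where f = "\<lambda>x. x / \<Delta>"]) (simp add: \<Delta>_def algebra_simps)
    then show ?thesis using assms(4) by simp
  qed
  have 3: "?u / \<Delta> * Im d + ?v / \<Delta> * Im e = Im (z - p)"
  proof -
    have "?u / \<Delta> * Im d + ?v / \<Delta> * Im e = (\<Delta> * Im (z - p)) / \<Delta>"
      unfolding times_divide_eq_left add_divide_distrib[symmetric]
      by (rule arg_cong[where f = "\<lambda>x. x / \<Delta>"]) (simp add: \<Delta>_def algebra_simps)
    then show ?thesis using assms(4) by simp
  qed
  show "k (h z) = z"
    using 2 3 unfolding k_def 1 by (intro complex_eqI) simp_all
  show "continuous_on S h"
    unfolding h_def Complex_eq using r assms(4) by (intro continuous_intros) auto
  show "continuous_on S k"
    unfolding k_def by (intro continuous_intros)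
qed

lemma cross_properly_at_segments:
  fixes a b c d p :: complex
  assumes p: "p \<in> open_segment a b" "p \<in> open_segment c d"
    and det: "Re (b - a) * Im (d - c) - Im (b - a) * Re (d - c) \<noteq> 0"
  shows "cross_properly_at (closed_segment a b) (closed_segment c d) p"
proof -
  obtain s where s: "0 < s" "s < 1" "p = (1 - s) *\<^sub>R a + s *\<^sub>R b"
    using p(1) by (auto simp: in_segment)
  obtain t where t: "0 < t" "t < 1" "p = (1 - t) *\<^sub>R c + t *\<^sub>R d"
    using p(2) by (auto simp: in_segment)
  \<comment> \<open>The scale \<open>r\<close> is the smallest parameter distance from
    \<open>p\<close> to an end of either segment. Thus \<open>k\<close> maps both axes of the unit
    disc into the segments, and the images below are full diameters.\<close>
  define r where "r = Min {s, 1 - s, t, 1 - t}"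
  have r: "r > 0" "r \<le> s" "r \<le> 1 - s" "r \<le> t" "r \<le> 1 - t"
    using s t unfolding r_def by auto
  define \<Delta> where "\<Delta> = Re (b - a) * Im (d - c) - Im (b - a) * Re (d - c)"
  define h where "h = (\<lambda>z. Complex ((Re (z - p) * Im (d - c) - Im (z - p) * Re (d - c)) / (\<Delta> * r))
                          ((Re (b - a) * Im (z - p) - Im (b - a) * Re (z - p)) / (\<Delta> * r)))"
  define k where "k = (\<lambda>w. p + of_real (r * Re w) * (b - a) + of_real (r * Im w) * (d - c))"
  note coord = linear_coordinates_inverse[OF det r(1), where p = p]
  have hk: "h (k w) = w" for w
    using coord(1)[of w] by (simp only: h_def k_def \<Delta>_def)
  have kh: "k (h z) = z" for z
    using coord(2)[of z] by (simp only: h_def k_def \<Delta>_def)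
  have cont: "continuous_on S h" "continuous_on S k" for S
    using coord(3,4)[of S] by (simp_all only: h_def k_def \<Delta>_def)
  define U where "U = k ` ball 0 1"
  have U: "U = h -` ball 0 1"
  proof (intro equalityI subsetI)
    fix z assume "z \<in> U"
    then show "z \<in> h -` ball 0 1" unfolding U_def by (auto simp: hk)
  next
    fix z assume "z \<in> h -` ball 0 1"
    then show "z \<in> U" unfolding U_def using kh[of z] by (metis image_eqI vimageE)
  qed
  have "open U"
    unfolding U using open_vimage[OF open_ball] cont(1) by blast
  moreover have hp: "h p = 0"
    by (simp add: h_def zero_complex.code)
  moreover have "p \<in> U"
    by (simp add: U hp)
  moreover have "homeomorphism U (ball 0 1) h k"
    unfolding homeomorphism_def using cont hk kh 
    by (auto simp: U_def image_image)
  moreover have "h ` (closed_segment a b \<inter> U) = {z \<in> ball 0 1. Im z = 0}"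
  proof (intro equalityI subsetI)
    fix w assume "w \<in> h ` (closed_segment a b \<inter> U)"
    then obtain z where z: "z \<in> closed_segment a b" "z \<in> U" "w = h z" by blast
    then obtain u where u: "z = (1 - u) *\<^sub>R a + u *\<^sub>R b" by (auto simp: in_segment)
    have "z - p = (u - s) *\<^sub>R (b - a)"
      unfolding u s(3) by (simp add: algebra_simps)
    then have "Im w = 0" unfolding z(3) h_def by simp
    then show "w \<in> {z \<in> ball 0 1. Im z = 0}" using z by (auto simp: U)
  next
    fix w :: complex assume w: "w \<in> {z \<in> ball 0 1. Im z = 0}"
    have "\<bar>Re w\<bar> < 1" using w abs_Re_le_cmod[of w] by simp
    then have "\<bar>r * Re w\<bar> < r" using r(1) by (simp add: abs_mult)
    then have "0 \<le> s + r * Re w" "s + r * Re w \<le> 1" using r by linarith+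
    moreover have "k w = (1 - (s + r * Re w)) *\<^sub>R a + (s + r * Re w) *\<^sub>R b"
      using w unfolding k_def s(3) by (simp add: scaleR_conv_of_real algebra_simps)
    ultimately have "k w \<in> closed_segment a b" by (auto simp: in_segment)
    then show "w \<in> h ` (closed_segment a b \<inter> U)"
      using hk[of w] w by (force simp: U_def image_iff)
  qed
  moreover have "h ` (closed_segment c d \<inter> U) = {z \<in> ball 0 1. Re z = 0}"
  proof (intro equalityI subsetI)
    fix w assume "w \<in> h ` (closed_segment c d \<inter> U)"
    then obtain z where z: "z \<in> closed_segment c d" "z \<in> U" "w = h z" by blast
    then obtain u where u: "z = (1 - u) *\<^sub>R c + u *\<^sub>R d" by (auto simp: in_segment)
    have "z - p = (u - t) *\<^sub>R (d - c)"
      unfolding u t(3) by (simp add: algebra_simps)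
    then have "Re w = 0" unfolding z(3) h_def by simp
    then show "w \<in> {z \<in> ball 0 1. Re z = 0}" using z by (auto simp: U)
  next
    fix w :: complex assume w: "w \<in> {z \<in> ball 0 1. Re z = 0}"
    have "\<bar>Im w\<bar> < 1" using w abs_Im_le_cmod[of w] by simp
    then have "\<bar>r * Im w\<bar> < r" using r(1) by (simp add: abs_mult)
    then have "0 \<le> t + r * Im w" "t + r * Im w \<le> 1" using r by linarith+
    moreover have "k w = (1 - (t + r * Im w)) *\<^sub>R c + (t + r * Im w) *\<^sub>R d"
      using w unfolding k_def t(3) by (simp add: scaleR_conv_of_real algebra_simps)
    ultimately have "k w \<in> closed_segment c d" by (auto simp: in_segment)
    then show "w \<in> h ` (closed_segment c d \<inter> U)"
      using hk[of w] w by (force simp: U_def image_iff)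
  qed
  ultimately show ?thesis unfolding cross_properly_at_def by blast
qed

text \<open>Each edge is a set, so it is oriented by an arbitrary choice.\<close>

definition straight_edges :: "('a \<Rightarrow> complex) \<Rightarrow> 'a set \<Rightarrow> real \<Rightarrow> complex" where
  "straight_edges pos e = (case SOME (u, v). e = {u, v} of (u, v) \<Rightarrow> linepath (pos u) (pos v))"

text \<open>The pair picked by \<open>SOME\<close> is unknown, but it has the right underlying set,
  so only the orientation is open. Image, set of ends and injectivity do not depend on it.\<close>

lemma straight_edges_cases:
  "straight_edges pos {u, v} = linepath (pos u) (pos v) \<or>
   straight_edges pos {u, v} = linepath (pos v) (pos u)"
proof -
  obtain x y where xy: "(SOME (x, y). {u, v} = {x, y}) = (x, y)" by (meson surj_pair)
  have "case (SOME (x, y). {u, v} = {x, y}) of (x, y) \<Rightarrow> {u, v} = {x, y}"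
    by (rule someI[of _ "(u, v)"]) simp
  then have "{u, v} = {x, y}" using xy by simp
  then show ?thesis unfolding straight_edges_def xy by (auto simp: doubleton_eq_iff)
qed

lemma path_image_straight_edges:
  "path_image (straight_edges pos {u, v}) = closed_segment (pos u) (pos v)"
  using straight_edges_cases[of pos u v] by (auto simp: closed_segment_commute)

lemma ends_straight_edges:
  "{pathstart (straight_edges pos {u, v}), pathfinish (straight_edges pos {u, v})} = pos ` {u, v}"
  using straight_edges_cases[of pos u v] by auto

lemma arc_straight_edges:
  "pos u \<noteq> pos v \<Longrightarrow> arc (straight_edges pos {u, v})"
  using straight_edges_cases[of pos u v] by auto


section \<open>Evasion\<close>

text \<open>\<open>Q\<close> describes positions with the robber to move, \<open>good\<close> those
  with the cops to move. Since \<open>init\<close> and \<open>step\<close> always lead into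
  \<open>good\<close>, the robber can alternate between the two forever, against any given
  \<open>\<sigma>\<close>.\<close>

lemma not_cops_win_if_invariant:
  fixes G :: "'a pair_pre_digraph" and Q :: "(nat \<Rightarrow> 'a) \<Rightarrow> 'a \<Rightarrow> bool" and k :: nat
  defines "good \<equiv> \<lambda>c y. (\<forall>i<k. c i \<noteq> y) \<and>
    (\<forall>c'. (\<forall>i<k. game_step G (c i) (c' i)) \<longrightarrow> Q c' y)"
  assumes nonempty: "pverts G \<noteq> {}"
    and init: "\<And>c. \<forall>i<k. c i \<in> pverts G \<Longrightarrow> \<exists>x\<in>pverts G. good c x"
    and step: "\<And>c x. Q c x \<Longrightarrow> \<exists>y. game_step G x y \<and> good c y"
    and safe: "\<And>c x i. Q c x \<Longrightarrow> i < k \<Longrightarrow> c i \<noteq> x"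
  shows "\<not> cops_win G k"
proof
  assume "cops_win G k"
  then obtain \<sigma> where \<sigma>: "\<And>r. robber_play G r \<Longrightarrow>
      cop_play G k (cop_response \<sigma> r) \<and> captured k (cop_response \<sigma> r) r"
    unfolding cops_win_def by blast
  \<comment> \<open>The placement \<open>\<sigma> []\<close> is made before the robber appears, so
    any legal play, here a constant one, shows that it consists of vertices.\<close>
  obtain v where v: "v \<in> pverts G" using nonempty by blast
  then have "robber_play G (\<lambda>_. v)" by (simp add: robber_play_def game_step_def)
  from \<sigma>[OF this] have "\<forall>i<k. \<sigma> [] i \<in> pverts G"
    by (simp add: cop_play_def cop_response_def)
  from init[OF this] obtain x0 where x0: "x0 \<in> pverts G" "good (\<sigma> []) x0" by blast
  \<comment> \<open>The default of staying put makes the robber's play legal unconditionally. This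
    has to come first: \<open>\<sigma>\<close> is known to move legally only against legal plays,
    and the invariant relies on legal cop moves.\<close>
  define move where "move = (\<lambda>c x. if \<exists>y. game_step G x y \<and> good c y
    then SOME y. game_step G x y \<and> good c y else x)"
  have move: "game_step G x (move c x)" for c x
    using someI_ex[of "\<lambda>y. game_step G x y \<and> good c y"] by (auto simp: move_def game_step_def)
  have move_good: "good c (move c x)" if "Q c x" for c x
    using someI_ex[OF step[OF that]] step[OF that] by (simp add: move_def)
  \<comment> \<open>The recursion runs over the whole history, as \<open>\<sigma>\<close> takes the
    list of all robber positions and not just the last one.\<close>
  define H where "H = rec_nat [x0] (\<lambda>_ h. h @ [move (\<sigma> h) (last h)])"
  define r where "r = (\<lambda>n. last (H n))"
  define C where "C = cop_response \<sigma> r"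
  have H: "H n = map r [0..<Suc n]" for n
    by (induction n) (simp_all add: H_def r_def)
  have C_Suc: "C (Suc n) = \<sigma> (H n)" for n
    by (simp only: C_def cop_response_def H)
  have r_0: "r 0 = x0" and r_Suc: "r (Suc n) = move (C (Suc n)) (r n)" for n
    by (simp_all add: C_Suc) (simp_all add: H_def r_def)
  have "robber_play G r"
    using x0 move by (simp add: robber_play_def r_0 r_Suc)
  then have play: "cop_play G k C" and cap: "captured k C r"
    using \<sigma> by (simp_all add: C_def)
  have good: "good (C n) (r n)" for n
  proof (induction n)
    case 0
    show ?case using x0 by (simp add: r_0 C_def cop_response_def)
  next
    case (Suc n)
    then have "Q (C (Suc n)) (r n)"
      using play by (simp add: good_def cop_play_def)
    then show ?case by (simp add: r_Suc move_good)
  qed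
  \<comment> \<open>This excludes capture by a cop move through \<open>safe\<close>;
    \<open>good\<close> excludes capture after a robber move.\<close>
  have "Q (C (Suc n)) (r n)" for n
    using good[of n] play by (simp add: good_def cop_play_def)
  then show False
    using cap good safe by (fastforce simp: captured_def good_def)
qed

text \<open>
  The robber runs towards a target \<open>w\<close> to which he is closer than every cop. This stays true
  while he runs, so he is not caught on the way and reaches \<open>w\<close> before the cops do.
\<close>

lemma not_cops_win_if_escape:
  fixes G :: "'a pair_pre_digraph" and f :: "'w \<Rightarrow> 'a \<Rightarrow> nat" and k L :: nat
  assumes wf: "pair_wf_digraph G" and nonempty: "pverts G \<noteq> {}"
    and lipschitz: "\<And>w x y. w \<in> B \<Longrightarrow> (x, y) \<in> parcs G \<Longrightarrow> f w x \<le> Suc (f w y)"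
    and descend: "\<And>w x. w \<in> B \<Longrightarrow> x \<in> pverts G \<Longrightarrow> 0 < f w x \<Longrightarrow> f w x \<le> L \<Longrightarrow>
      \<exists>y. (x, y) \<in> parcs G \<and> f w y < f w x"
    and escape: "\<And>w x c. w \<in> B \<Longrightarrow> x \<in> pverts G \<Longrightarrow> f w x = 0 \<Longrightarrow>
      \<forall>i<k. c i \<in> pverts G \<and> 0 < f w (c i) \<Longrightarrow>
      \<exists>w'\<in>B. 0 < f w' x \<and> f w' x \<le> L \<and> (\<forall>i<k. f w' x < f w' (c i))"
    and start: "\<And>c. \<forall>i<k. c i \<in> pverts G \<Longrightarrow>
      \<exists>w\<in>B. \<exists>x\<in>pverts G. f w x = 0 \<and> (\<forall>i<k. 1 < f w (c i))"
  shows "\<not> cops_win G k"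
proof -
  interpret pair_wf_digraph G by (rule wf)
  define Q where "Q = (\<lambda>c x. x \<in> pverts G \<and> (\<forall>i<k. c i \<in> pverts G) \<and>
    (\<exists>w\<in>B. f w x \<le> L \<and> (\<forall>i<k. f w x < f w (c i))))"
  have verts_step: "v \<in> pverts G" if "game_step G u v" "u \<in> pverts G" for u v
    using that by (auto simp: game_step_def dest: in_arcsD2)
  have lip: "f w u \<le> Suc (f w v)" if "game_step G u v" "w \<in> B" for u v w
    using that lipschitz by (auto simp: game_step_def)
  \<comment> \<open>The reply of the cops lowers each \<open>f w (c i)\<close> by at most one, so a
    lead of two after the robber's move leaves the strict lead that \<open>Q\<close>
    demands.\<close>
  have follow: "Q c' y"
    if "y \<in> pverts G" "\<forall>i<k. c i \<in> pverts G" "w \<in> B" "f w y \<le> L"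
      "\<forall>i<k. Suc (f w y) < f w (c i)" "\<forall>i<k. game_step G (c i) (c' i)" for c c' y w
  proof -
    have "f w y < f w (c' i)" if "i < k" for i
    proof -
      have "Suc (f w y) < f w (c i)" "f w (c i) \<le> Suc (f w (c' i))"
        using \<open>\<forall>i<k. Suc (f w y) < f w (c i)\<close> \<open>\<forall>i<k. game_step G (c i) (c' i)\<close> \<open>i < k\<close>
          lip[OF _ \<open>w \<in> B\<close>] by blast+
      then show ?thesis by linarith
    qed
    then show ?thesis
      using that verts_step unfolding Q_def by blast
  qed
  show ?thesis
  proof (rule not_cops_win_if_invariant[OF nonempty, where Q = Q])
    fix c assume c: "\<forall>i<k. c i \<in> pverts G"
    from start[OF this] obtain w x where
      wx: "w \<in> B" "x \<in> pverts G" "f w x = 0" "\<forall>i<k. 1 < f w (c i)" by blast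
    have "c i \<noteq> x" if "i < k" for i using wx(3,4) that by auto
    moreover have "Q c' x" if "\<forall>i<k. game_step G (c i) (c' i)" for c'
      using wx by (intro follow[OF wx(2) c wx(1) _ _ that]) auto
    ultimately show "\<exists>x\<in>pverts G. (\<forall>i<k. c i \<noteq> x) \<and>
        (\<forall>c'. (\<forall>i<k. game_step G (c i) (c' i)) \<longrightarrow> Q c' x)"
      using wx(2) by blast
  next
    fix c x assume Q: "Q c x"
    then have x: "x \<in> pverts G" and c: "\<forall>i<k. c i \<in> pverts G" by (auto simp: Q_def)
    from Q obtain w where w: "w \<in> B" "f w x \<le> L" "\<forall>i<k. f w x < f w (c i)"
      by (auto simp: Q_def)
    \<comment> \<open>A new target is chosen only on arrival at the old one; the strict lead then
      says that no cop is there, as \<open>escape\<close> requires.\<close>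
    obtain w' where w': "w' \<in> B" "0 < f w' x" "f w' x \<le> L" "\<forall>i<k. f w' x < f w' (c i)"
    proof (cases "f w x = 0")
      case True
      have "\<forall>i<k. c i \<in> pverts G \<and> 0 < f w (c i)" using c w(3) True by auto
      from escape[OF w(1) x True this] show ?thesis using that by blast
    next
      case False
      then show ?thesis using that w by blast
    qed
    from descend[OF w'(1) x w'(2,3)] obtain y where
      y: "(x, y) \<in> parcs G" "f w' y < f w' x" by blast
    have less: "\<forall>i<k. Suc (f w' y) < f w' (c i)"
      using w'(4) y(2) by fastforce
    then have "\<forall>i<k. c i \<noteq> y" by auto
    moreover have "Q c' y" if "\<forall>i<k. game_step G (c i) (c' i)" for c'
      using y w'(3) by (intro follow[OF _ c w'(1) _ less that]) (auto dest: in_arcsD2)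
    ultimately show "\<exists>y. game_step G x y \<and> (\<forall>i<k. c i \<noteq> y) \<and>
        (\<forall>c'. (\<forall>i<k. game_step G (c i) (c' i)) \<longrightarrow> Q c' y)"
      using y(1) by (auto simp: game_step_def)
  next
    show "c i \<noteq> x" if "Q c x" "i < k" for c x i
      using that by (auto simp: Q_def)
  qed
qed

text \<open>Pigeonhole: each of the \<open>k\<close> cops spoils at most one of more than
  \<open>k\<close> candidates.\<close>

lemma exists_avoiding:
  assumes "k < card A" and "finite A"
    and "\<And>i x y. i < k \<Longrightarrow> x \<in> A \<Longrightarrow> y \<in> A \<Longrightarrow> P i x \<Longrightarrow> P i y \<Longrightarrow> x = y"
  shows "\<exists>x\<in>A. \<forall>i<k. \<not> P i x"
proof (rule ccontr)
  assume "\<not> ?thesis"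
  then have "A \<subseteq> (\<Union>i<k. {x \<in> A. P i x})" by blast
  then have "card A \<le> card (\<Union>i<k. {x \<in> A. P i x})"
    using assms(2) by (intro card_mono) auto
  also have "\<dots> \<le> (\<Sum>i<k. card {x \<in> A. P i x})"
    by (rule card_UN_le) simp
  also have "\<dots> \<le> (\<Sum>i<k. 1)"
  proof (rule sum_mono)
    fix i assume "i \<in> {..<k}"
    then have "\<forall>x\<in>{x \<in> A. P i x}. \<forall>y\<in>{x \<in> A. P i x}. x = y"
      using assms(3)[of i] by blast
    then show "card {x \<in> A. P i x} \<le> 1"
      using assms(2) by (simp add: card_le_Suc0_iff_eq)
  qed
  finally show False using assms(1) by simp
qed


section \<open>Uniform subdivisions of bipartite graphs\<close>

text \<open>
  The \<open>j\<close>-th vertex on the path replacing the edge \<open>(a, b)\<close>. All paths of \<open>a\<close> start in one vertex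
  and all paths of \<open>b\<close> end in one vertex, so \<open>b\<close> is erased for \<open>j = 0\<close> and \<open>a\<close> for \<open>j = L\<close>.
\<close>

definition vtx :: "nat \<Rightarrow> nat \<Rightarrow> nat \<Rightarrow> nat \<Rightarrow> nat" where
  "vtx L a b j = prod_encode (if j < L then a else 0, prod_encode (if 0 < j then b else 0, j))"

lemma vtx_eq_iff:
  "vtx L a b j = vtx L a' b' j' \<longleftrightarrow> j = j' \<and> (j < L \<longrightarrow> a = a') \<and> (0 < j \<longrightarrow> b = b')"
  by (auto simp: vtx_def)

text \<open>Gives access to the coordinates of a vertex. An erased coordinate arrives as
  \<open>0\<close>, so a sensible \<open>g\<close> ignores \<open>b\<close> at \<open>j = 0\<close>
  and \<open>a\<close> at \<open>j = L\<close>.\<close>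

definition vtx_case :: "(nat \<Rightarrow> nat \<Rightarrow> nat \<Rightarrow> 'a) \<Rightarrow> nat \<Rightarrow> 'a" where
  "vtx_case g v = (case prod_decode v of (a, r) \<Rightarrow> case prod_decode r of (b, j) \<Rightarrow> g a b j)"

lemma vtx_case_vtx:
  "vtx_case g (vtx L a b j) = g (if j < L then a else 0) (if 0 < j then b else 0) j"
  by (simp add: vtx_case_def vtx_def)

definition subdivision :: "(nat \<times> nat) set \<Rightarrow> nat \<Rightarrow> nat pair_pre_digraph" where
  "subdivision R L =
    \<lparr>pverts = {vtx L a b j | a b j. (a, b) \<in> R \<and> j \<le> L},
     parcs = {(vtx L a b i, vtx L a b j) | a b i j.
       (a, b) \<in> R \<and> i \<le> L \<and> j \<le> L \<and> (j = Suc i \<or> i = Suc j)}\<rparr>"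

lemma pverts_subdivisionI: "(a, b) \<in> R \<Longrightarrow> j \<le> L \<Longrightarrow> vtx L a b j \<in> pverts (subdivision R L)"
  by (auto simp: subdivision_def)

lemma pverts_subdivisionE:
  assumes "v \<in> pverts (subdivision R L)"
  obtains a b j where "(a, b) \<in> R" "j \<le> L" "v = vtx L a b j"
  using assms by (auto simp: subdivision_def)

lemma parcs_subdivisionI:
  "(a, b) \<in> R \<Longrightarrow> i \<le> L \<Longrightarrow> j \<le> L \<Longrightarrow> j = Suc i \<or> i = Suc j \<Longrightarrow>
    (vtx L a b i, vtx L a b j) \<in> parcs (subdivision R L)"
  unfolding subdivision_def by fastforce

lemma parcs_subdivisionE:
  assumes "(u, v) \<in> parcs (subdivision R L)"
  obtains a b i j where "(a, b) \<in> R" "i \<le> L" "j \<le> L" "j = Suc i \<or> i = Suc j"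
    "u = vtx L a b i" "v = vtx L a b j"
  using assms by (auto simp: subdivision_def)

lemma uedges_subdivisionE:
  assumes "e \<in> uedges (subdivision R L)"
  obtains a b j where "(a, b) \<in> R" "j < L" "e = {vtx L a b j, vtx L a b (Suc j)}"
proof -
  from assms obtain u v where e: "e = {u, v}" "(u, v) \<in> parcs (subdivision R L)"
    by (auto simp: uedges_def)
  then obtain a b i j where "(a, b) \<in> R" "i \<le> L" "j \<le> L" "j = Suc i \<or> i = Suc j"
    "u = vtx L a b i" "v = vtx L a b j"
    by (elim parcs_subdivisionE)
  with e that[of a b i] that[of a b j] show ?thesis by (auto simp: insert_commute)
qed

lemma pair_graph_subdivision:
  assumes "finite R"
  shows "pair_graph (subdivision R L)"
proof -
  interpret pair_wf_digraph "subdivision R L"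
    by unfold_locales (auto elim!: parcs_subdivisionE intro!: pverts_subdivisionI)
  have "pverts (subdivision R L) = (\<Union>(a, b)\<in>R. \<Union>j\<le>L. {vtx L a b j})"
    by (auto simp: subdivision_def)
  then have V: "finite (pverts (subdivision R L))"
    using assms by auto
  have "parcs (subdivision R L) \<subseteq> pverts (subdivision R L) \<times> pverts (subdivision R L)"
    by (auto dest: wellformed')
  then have E: "finite (parcs (subdivision R L))"
    using V by (auto intro: finite_subset)
  have "symmetric (subdivision R L)"
    unfolding symmetric_def by (intro symI) (auto elim!: parcs_subdivisionE intro: parcs_subdivisionI)
  with V E show ?thesis
    by unfold_locales (auto elim!: parcs_subdivisionE simp: vtx_eq_iff)
qed

text \<open>Adjacency in the line graph of the bipartite graph \<open>R\<close>, loops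
  included.\<close>

definition share_end :: "(nat \<times> nat) set \<Rightarrow> ((nat \<times> nat) \<times> (nat \<times> nat)) set" where
  "share_end R = {(e, e'). e \<in> R \<and> e' \<in> R \<and> (fst e = fst e' \<or> snd e = snd e')}"

text \<open>Each path is connected in itself, and the paths of two edges with a common end meet in
  the branch vertex at \<open>j = 0\<close> or \<open>j = L\<close>.\<close>

lemma connected_subdivision:
  assumes "finite R" and "R \<noteq> {}"
    and conn: "\<And>e e'. e \<in> R \<Longrightarrow> e' \<in> R \<Longrightarrow> (e, e') \<in> (share_end R)\<^sup>*"
  shows "Digraph_Component.connected (with_proj (subdivision R L))"
proof -
  let ?G = "subdivision R L"
  interpret pair_graph ?G by (rule pair_graph_subdivision[OF assms(1)])
  have sym: "u \<rightarrow>\<^sup>*\<^bsub>?G\<^esub> v \<Longrightarrow> v \<rightarrow>\<^sup>*\<^bsub>?G\<^esub> u" for u v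
    using symmetric_reachable[OF pair_sym_arcs] by blast
  have from_start: "vtx L a b 0 \<rightarrow>\<^sup>*\<^bsub>?G\<^esub> vtx L a b j" if "(a, b) \<in> R" "j \<le> L" for a b j
    using that(2)
  proof (induction j)
    case 0
    then show ?case using that(1) by (simp add: pverts_subdivisionI)
  next
    case (Suc j)
    have "(vtx L a b j, vtx L a b (Suc j)) \<in> parcs ?G"
      using that(1) Suc.prems by (intro parcs_subdivisionI) auto
    then show ?case using Suc by (auto intro: reachable_adj_trans)
  qed
  have along: "vtx L a b i \<rightarrow>\<^sup>*\<^bsub>?G\<^esub> vtx L a b j" if "(a, b) \<in> R" "i \<le> L" "j \<le> L" for a b i j
    using from_start[OF that(1,2)] from_start[OF that(1,3)] sym reachable_trans by blast
  have starts: "vtx L (fst e) (snd e) 0 \<rightarrow>\<^sup>*\<^bsub>?G\<^esub> vtx L (fst e') (snd e') 0"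
    if "(e, e') \<in> (share_end R)\<^sup>*" "e \<in> R" for e e'
    using that(1)
  proof (induction rule: rtrancl_induct)
    case base
    show ?case using that(2) along[of "fst e" "snd e" 0 0] by simp
  next
    case (step e1 e2)
    then have R: "(fst e1, snd e1) \<in> R" "(fst e2, snd e2) \<in> R"
      and ends: "fst e1 = fst e2 \<or> snd e1 = snd e2"
      by (auto simp: share_end_def)
    have "vtx L (fst e1) (snd e1) 0 \<rightarrow>\<^sup>*\<^bsub>?G\<^esub> vtx L (fst e2) (snd e2) 0"
    proof (cases "fst e1 = fst e2")
      case True
      then have "vtx L (fst e1) (snd e1) 0 = vtx L (fst e2) (snd e2) 0"
        by (simp add: vtx_eq_iff)
      then show ?thesis using along[OF R(2), of 0 0] by simp
    next
      case False
      then have "vtx L (fst e1) (snd e1) L = vtx L (fst e2) (snd e2) L"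
        using ends by (simp add: vtx_eq_iff)
      then show ?thesis
        using along[OF R(1), of 0 L] along[OF R(2), of L 0] reachable_trans by simp
    qed
    with step.IH show ?case by (rule reachable_trans)
  qed
  have "u \<rightarrow>\<^sup>*\<^bsub>?G\<^esub> v" if uv: "u \<in> pverts ?G" "v \<in> pverts ?G" for u v
  proof -
    obtain a b j where u: "(a, b) \<in> R" "j \<le> L" "u = vtx L a b j"
      using uv(1) by (rule pverts_subdivisionE)
    obtain a' b' j' where v: "(a', b') \<in> R" "j' \<le> L" "v = vtx L a' b' j'"
      using uv(2) by (rule pverts_subdivisionE)
    have "vtx L a b j \<rightarrow>\<^sup>*\<^bsub>?G\<^esub> vtx L a b 0" using along u by blast
    also have "vtx L a b 0 \<rightarrow>\<^sup>*\<^bsub>?G\<^esub> vtx L a' b' 0"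
      using starts[OF conn[OF u(1) v(1)] u(1)] by simp
    also have "vtx L a' b' 0 \<rightarrow>\<^sup>*\<^bsub>?G\<^esub> vtx L a' b' j'" using along v by blast
    finally show ?thesis by (simp add: u v)
  qed
  moreover have "pverts ?G \<noteq> {}"
    using assms(2) pverts_subdivisionI[of _ _ R 0 L] by fastforce
  ultimately have "strongly_connected ?G"
    by (intro strongly_connectedI) auto
  then show ?thesis
    using reachable_mk_symmetric_eq[OF pair_sym_arcs]
    unfolding Digraph_Component.connected_def strongly_connected_def
    by (simp add: mk_symmetric_def)
qed

text \<open>The distances from the two kinds of branch vertices, cut off at \<open>Suc L\<close>.\<close>

definition branch_dist :: "(nat \<times> nat) set \<Rightarrow> nat \<Rightarrow> nat + nat \<Rightarrow> nat \<Rightarrow> nat" where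
  "branch_dist R L w = vtx_case (\<lambda>a b j. case w of
     Inl a0 \<Rightarrow> if j = L then (if (a0, b) \<in> R then L else Suc L) else if a = a0 then j else Suc L
   | Inr b0 \<Rightarrow> if j = 0 then (if (a, b0) \<in> R then L else Suc L) else if b = b0 then L - j else Suc L)"

lemma branch_dist_Inl:
  assumes "j \<le> L" "0 < L"
  shows "branch_dist R L (Inl a0) (vtx L a b j) =
    (if j = L then (if (a0, b) \<in> R then L else Suc L) else if a = a0 then j else Suc L)"
  using assms by (simp add: branch_dist_def vtx_case_vtx)

lemma branch_dist_Inr:
  assumes "j \<le> L" "0 < L"
  shows "branch_dist R L (Inr b0) (vtx L a b j) =
    (if j = 0 then (if (a, b0) \<in> R then L else Suc L) else if b = b0 then L - j else Suc L)"
  using assms by (simp add: branch_dist_def vtx_case_vtx)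

text \<open>Three kinds of cop positions matter when the robber is on a branch vertex. Inside a
  path, a cop is within \<open>L\<close> only of the two ends, one on each side. On a branch vertex
  of the opposite side, he is within \<open>L\<close> of that vertex alone on that side. On another
  branch vertex of the robber's side, he shares at most one neighbour with the robber; only this
  case uses \<open>no_C4\<close>.\<close>

lemma not_cops_win_subdivision:
  assumes "finite R" and L: "2 \<le> L"
    and no_C4: "\<And>a a' b b'. (a, b) \<in> R \<Longrightarrow> (a, b') \<in> R \<Longrightarrow> (a', b) \<in> R \<Longrightarrow> (a', b') \<in> R \<Longrightarrow>
      a = a' \<or> b = b'"
    and deg_left: "\<And>a. a \<in> fst ` R \<Longrightarrow> k < card {b. (a, b) \<in> R}"
    and deg_right: "\<And>b. b \<in> snd ` R \<Longrightarrow> k < card {a. (a, b) \<in> R}"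
    and "R \<noteq> {}"
  shows "\<not> cops_win (subdivision R L) k"
proof -
  let ?G = "subdivision R L" and ?d = "branch_dist R L"
  interpret pair_graph ?G by (rule pair_graph_subdivision[OF assms(1)])
  define B where "B = Inl ` fst ` R \<union> Inr ` snd ` R"
  have pos: "0 < L" using L by simp
  note dist = branch_dist_Inl[OF _ pos] branch_dist_Inr[OF _ pos]
  have fin: "finite (fst ` R)" "finite {b. (a, b) \<in> R}" "finite {a. (a, b) \<in> R}" for a b
    using assms(1) finite_vimageI[of R "Pair a"] finite_vimageI[of R "\<lambda>a. (a, b)"]
    by (auto simp: vimage_def inj_on_def)
  show ?thesis
  proof (rule not_cops_win_if_escape[where f = ?d and B = B and L = L])
    show "pair_wf_digraph ?G" ..
    show "pverts ?G \<noteq> {}"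
      using \<open>R \<noteq> {}\<close> pverts_subdivisionI[of _ _ R 0 L] by fastforce
  next
    fix w x y assume "w \<in> B" "(x, y) \<in> parcs ?G"
    then obtain a b i j where *: "(a, b) \<in> R" "i \<le> L" "j \<le> L" "j = Suc i \<or> i = Suc j"
      "x = vtx L a b i" "y = vtx L a b j"
      by (elim parcs_subdivisionE)
    show "?d w x \<le> Suc (?d w y)"
      using * by (cases w) (auto simp: dist)
  next
    fix w x assume w: "w \<in> B" "x \<in> pverts ?G" "0 < ?d w x" "?d w x \<le> L"
    then obtain a b j where x: "(a, b) \<in> R" "j \<le> L" "x = vtx L a b j"
      by (elim pverts_subdivisionE)
    show "\<exists>y. (x, y) \<in> parcs ?G \<and> ?d w y < ?d w x"
    proof (cases w)
      case (Inl a0)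
      show ?thesis
      proof (cases "j = L")
        case True
        with w x Inl have a0: "(a0, b) \<in> R" by (auto simp: dist split: if_splits)
        have "x = vtx L a0 b L" using x True pos by (simp add: vtx_eq_iff)
        moreover have "(vtx L a0 b L, vtx L a0 b (L - 1)) \<in> parcs ?G"
          using a0 pos by (intro parcs_subdivisionI) auto
        moreover have "?d w (vtx L a0 b (L - 1)) < ?d w (vtx L a0 b L)"
          using pos a0 by (simp add: dist Inl)
        ultimately show ?thesis by blast
      next
        case False
        with w x Inl have a0: "a = a0" "0 < j" by (auto simp: dist split: if_splits)
        have "(vtx L a b j, vtx L a b (j - 1)) \<in> parcs ?G"
          using x a0 by (intro parcs_subdivisionI) auto
        moreover have "?d w (vtx L a b (j - 1)) < ?d w (vtx L a b j)"
          using x False a0 by (simp add: dist Inl)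
        ultimately show ?thesis using x(3) by blast
      qed
    next
      case (Inr b0)
      show ?thesis
      proof (cases "j = 0")
        case True
        with w x Inr have b0: "(a, b0) \<in> R" by (auto simp: dist split: if_splits)
        have "x = vtx L a b0 0" using x True pos by (simp add: vtx_eq_iff)
        moreover have "(vtx L a b0 0, vtx L a b0 1) \<in> parcs ?G"
          using b0 pos by (intro parcs_subdivisionI) auto
        moreover have "?d w (vtx L a b0 1) < ?d w (vtx L a b0 0)"
          using pos b0 by (simp add: dist Inr)
        ultimately show ?thesis by blast
      next
        case False
        with w x Inr have b0: "b = b0" "j < L" by (auto simp: dist split: if_splits)
        have "(vtx L a b j, vtx L a b (Suc j)) \<in> parcs ?G"
          using x b0 by (intro parcs_subdivisionI) auto
        moreover have "?d w (vtx L a b (Suc j)) < ?d w (vtx L a b j)"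
          using x False b0 by (simp add: dist Inr)
        ultimately show ?thesis using x(3) by blast
      qed
    qed
  next
    fix w x c assume w: "w \<in> B" "x \<in> pverts ?G" "?d w x = 0"
      and c: "\<forall>i<k. c i \<in> pverts ?G \<and> 0 < ?d w (c i)"
    obtain a b j where x: "(a, b) \<in> R" "j \<le> L" "x = vtx L a b j"
      using w(2) by (rule pverts_subdivisionE)
    show "\<exists>w'\<in>B. 0 < ?d w' x \<and> ?d w' x \<le> L \<and> (\<forall>i<k. ?d w' x < ?d w' (c i))"
    proof (cases w)
      case (Inl a0)
      with w x pos have a0: "a = a0" "j = 0" by (auto simp: dist split: if_splits)
      \<comment> \<open>The robber is at distance exactly \<open>L\<close> from every candidate, so
        a cop farther than \<open>L\<close> loses the race.\<close>
      have "\<exists>b'\<in>{b. (a, b) \<in> R}. \<forall>i<k. \<not> ?d (Inr b') (c i) \<le> L"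
      proof (rule exists_avoiding)
        show "k < card {b. (a, b) \<in> R}" using x(1) by (force intro: deg_left)
        fix i b1 b2 assume i: "i < k" and b: "b1 \<in> {b. (a, b) \<in> R}" "b2 \<in> {b. (a, b) \<in> R}"
          "?d (Inr b1) (c i) \<le> L" "?d (Inr b2) (c i) \<le> L"
        from c i obtain \<alpha> \<beta> l where ci: "(\<alpha>, \<beta>) \<in> R" "l \<le> L" "c i = vtx L \<alpha> \<beta> l"
          by (blast elim: pverts_subdivisionE)
        have "0 < ?d w (c i)" using c i by blast
        then show "b1 = b2"
          using b ci no_C4[of a b1 b2 \<alpha>] pos by (auto simp: dist Inl a0 split: if_splits)
      qed (simp add: fin)
      then obtain b' where b': "(a, b') \<in> R" "\<forall>i<k. L < ?d (Inr b') (c i)"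
        by (auto simp: not_le)
      have "?d (Inr b') x = L" using x a0 b' by (simp add: dist)
      moreover have "Inr b' \<in> B" using b'(1) by (force simp: B_def)
      ultimately show ?thesis using b'(2) pos by (intro bexI[of _ "Inr b'"]) auto
    next
      case (Inr b0)
      with w x pos have b0: "b = b0" "j = L" by (auto simp: dist split: if_splits)
      have "\<exists>a'\<in>{a. (a, b) \<in> R}. \<forall>i<k. \<not> ?d (Inl a') (c i) \<le> L"
      proof (rule exists_avoiding)
        show "k < card {a. (a, b) \<in> R}" using x(1) by (force intro: deg_right)
        fix i a1 a2 assume i: "i < k" and a: "a1 \<in> {a. (a, b) \<in> R}" "a2 \<in> {a. (a, b) \<in> R}"
          "?d (Inl a1) (c i) \<le> L" "?d (Inl a2) (c i) \<le> L"
        from c i obtain \<alpha> \<beta> l where ci: "(\<alpha>, \<beta>) \<in> R" "l \<le> L" "c i = vtx L \<alpha> \<beta> l"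
          by (blast elim: pverts_subdivisionE)
        have "0 < ?d w (c i)" using c i by blast
        then show "a1 = a2"
          using a ci no_C4[of a1 b \<beta> a2] pos by (auto simp: dist Inr b0 split: if_splits)
      qed (simp add: fin)
      then obtain a' where a': "(a', b) \<in> R" "\<forall>i<k. L < ?d (Inl a') (c i)"
        by (auto simp: not_le)
      have "?d (Inl a') x = L" using x b0 a' by (simp add: dist)
      moreover have "Inl a' \<in> B" using a'(1) by (force simp: B_def)
      ultimately show ?thesis using a'(2) pos by (intro bexI[of _ "Inl a'"]) auto
    qed
  next
    fix c assume c: "\<forall>i<k. c i \<in> pverts ?G"
    obtain a b where ab: "(a, b) \<in> R" using \<open>R \<noteq> {}\<close> by auto
    \<comment> \<open>The cops move next, hence the threshold one. By \<open>2 \<le> L\<close> a cop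
      on the side of \<open>b\<close> is too far away to threaten any candidate, and any other cop
      threatens at most one.\<close>
    have "\<exists>a'\<in>{a. (a, b) \<in> R}. \<forall>i<k. \<not> ?d (Inl a') (c i) \<le> 1"
    proof (rule exists_avoiding)
      show "k < card {a. (a, b) \<in> R}" using ab by (force intro: deg_right)
      fix i a1 a2 assume i: "i < k" and a: "a1 \<in> {a. (a, b) \<in> R}" "a2 \<in> {a. (a, b) \<in> R}"
        "?d (Inl a1) (c i) \<le> 1" "?d (Inl a2) (c i) \<le> 1"
      from c i obtain \<alpha> \<beta> l where ci: "(\<alpha>, \<beta>) \<in> R" "l \<le> L" "c i = vtx L \<alpha> \<beta> l"
        by (blast elim: pverts_subdivisionE)
      then show "a1 = a2"
        using a L by (auto simp: dist split: if_splits)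
    qed (simp add: fin)
    then obtain a' where a': "(a', b) \<in> R" "\<forall>i<k. 1 < ?d (Inl a') (c i)"
      by (auto simp: not_le)
    moreover have "Inl a' \<in> B" using a'(1) by (force simp: B_def)
    moreover have "?d (Inl a') (vtx L a' b 0) = 0" using pos by (simp add: dist)
    moreover have "vtx L a' b 0 \<in> pverts ?G" using a'(1) by (simp add: pverts_subdivisionI)
    ultimately show "\<exists>w\<in>B. \<exists>x\<in>pverts ?G. ?d w x = 0 \<and> (\<forall>i<k. 1 < ?d w (c i))" by blast
  qed
qed


section \<open>Drawing a subdivision\<close>

text \<open>
  The vertices \<open>a\<close> and \<open>b\<close> of the two sides are placed on the lines \<open>Re z = 0\<close> and \<open>Re z = L\<close>,
  at heights \<open>L * a\<close> and \<open>L * rung N b\<close>. The heights \<open>rung N b\<close> grow so fast that no three edges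
  meet in a point, and the factor \<open>sqrt 2\<close> keeps crossings away from the subdivision vertices.
\<close>

definition rung :: "nat \<Rightarrow> nat \<Rightarrow> real" where
  "rung N b = sqrt 2 * real N ^ b"

definition on_edge :: "nat \<Rightarrow> nat \<Rightarrow> nat \<Rightarrow> nat \<Rightarrow> real \<Rightarrow> complex" where
  "on_edge N L a b x = Complex x ((real L - x) * real a + x * rung N b)"

lemma on_edge_eq_iff:
  "on_edge N L a b x = on_edge N L a' b' x' \<longleftrightarrow>
    x = x' \<and> (real L - x) * (real a - real a') = x * (rung N b' - rung N b)"
  by (auto simp: on_edge_def algebra_simps)

lemma rung_eq_iff: "1 < N \<Longrightarrow> rung N b = rung N b' \<longleftrightarrow> b = b'"
  by (simp add: rung_def)

text \<open>At an integer abscissa the equation says that an integer equals \<open>sqrt 2\<close>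
  times an integer, so both vanish. This forces equal ends, except for the end that
  \<open>vtx\<close> erases anyway.\<close>

lemma on_edge_at_integer:
  assumes N: "1 < N" and j: "j \<le> L" "0 < L"
    and eq: "on_edge N L a b (real j) = on_edge N L a' b' (real j)"
  shows "vtx L a b j = vtx L a' b' j"
proof -
  have *: "(real L - real j) * (real a - real a') = real j * (rung N b' - rung N b)"
    using eq by (simp add: on_edge_eq_iff)
  define m where "m = real j * (real N ^ b' - real N ^ b)"
  have m: "(real L - real j) * (real a - real a') = sqrt 2 * m"
    using * by (simp add: rung_def m_def algebra_simps)
  have "m = 0"
  proof (rule ccontr)
    assume "m \<noteq> 0"
    then have "sqrt 2 = ((real L - real j) * (real a - real a')) / m"
      using m by (simp add: field_simps)
    also have "\<dots> \<in> \<rat>"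
      unfolding m_def by (intro Rats_divide Rats_mult Rats_diff Rats_power Rats_of_nat)
    finally show False using sqrt2_irrational by blast
  qed
  then have "0 < j \<Longrightarrow> b = b'" "j < L \<Longrightarrow> a = a'"
    using m N by (auto simp: m_def)
  then show ?thesis by (simp add: vtx_eq_iff)
qed

text \<open>With \<open>u = L - x\<close>, the first equation gives \<open>a2 < a1\<close> and hence
  \<open>u \<le> x * rung (Suc N) b2\<close>. As rungs grow at least by the factor
  \<open>Suc N\<close>, the right side of the second equation is at least \<open>N * u\<close>. So
  \<open>a2 - a3\<close> would be at least \<open>N\<close>, although \<open>a2 < N\<close>.\<close>

lemma on_edge_concurrent_ordered:
  assumes x: "0 < x" "x < real L" and b: "b1 < b2" "b2 < b3"
    and a: "a1 < N" "a2 < N" "a3 < N"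
    and eq: "on_edge (Suc N) L a1 b1 x = on_edge (Suc N) L a2 b2 x"
      "on_edge (Suc N) L a2 b2 x = on_edge (Suc N) L a3 b3 x"
  shows False
proof -
  let ?r = "rung (Suc N)" and ?u = "real L - x"
  have e1: "?u * (real a1 - real a2) = x * (?r b2 - ?r b1)"
    and e2: "?u * (real a2 - real a3) = x * (?r b3 - ?r b2)"
    using eq[unfolded on_edge_eq_iff] by blast+
  have u: "0 < ?u" using x by simp
  have pos: "0 < ?r b" for b by (simp add: rung_def)
  have N: "0 < N" using a by simp
  have grow: "real (Suc N) * ?r b \<le> ?r b'" if "b < b'" for b b'
  proof -
    have "real (Suc N) ^ Suc b \<le> real (Suc N) ^ b'"
      using that by (intro power_increasing) auto
    then have "sqrt 2 * real (Suc N) ^ Suc b \<le> sqrt 2 * real (Suc N) ^ b'"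
      by (intro mult_left_mono) auto
    then show ?thesis by (simp only: rung_def power_Suc mult.left_commute)
  qed
  have "?r b1 < ?r b2"
    using b(1) N by (simp add: rung_def)
  then have "0 < ?u * (real a1 - real a2)" unfolding e1 using x by simp
  then have "a2 < a1" using u by (simp add: zero_less_mult_iff)
  then have "?u * 1 \<le> ?u * (real a1 - real a2)"
    using u by (intro mult_left_mono) auto
  also have "\<dots> \<le> x * ?r b2"
    unfolding e1 using x pos[of b1] by (intro mult_left_mono) auto
  finally have le: "?u \<le> x * ?r b2" by simp
  have "real N * ?u \<le> real N * (x * ?r b2)"
    using le by (intro mult_left_mono) auto
  also have "\<dots> = x * (real (Suc N) * ?r b2 - ?r b2)"
    by (simp add: algebra_simps)
  also have "\<dots> \<le> x * (?r b3 - ?r b2)"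
    using x grow[OF b(2)] by (intro mult_left_mono) auto
  also have "\<dots> = ?u * (real a2 - real a3)" by (simp add: e2)
  finally have "real N \<le> real a2 - real a3"
    using u by (simp add: mult.commute)
  then show False using a by linarith
qed

lemma on_edge_concurrent:
  assumes x: "0 < x" "x < real L" and a: "a1 < N" "a2 < N" "a3 < N"
    and eq: "on_edge (Suc N) L a1 b1 x = p" "on_edge (Suc N) L a2 b2 x = p"
      "on_edge (Suc N) L a3 b3 x = p"
  shows "b1 = b2 \<or> b2 = b3 \<or> b1 = b3"
proof (rule ccontr)
  note O = on_edge_concurrent_ordered[OF x]
  assume "\<not> ?thesis"
  then consider "b1 < b2" "b2 < b3" | "b1 < b3" "b3 < b2" | "b2 < b1" "b1 < b3"
    | "b2 < b3" "b3 < b1" | "b3 < b1" "b1 < b2" | "b3 < b2" "b2 < b1"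
    by linarith
  then show False
    using O[of b1 b2 b3 a1 N a2 a3] O[of b1 b3 b2 a1 N a3 a2] O[of b2 b1 b3 a2 N a1 a3]
      O[of b2 b3 b1 a2 N a3 a1] O[of b3 b1 b2 a3 N a1 a2] O[of b3 b2 b1 a3 N a2 a1] a eq
    by cases simp_all
qed

text \<open>\<open>rung N b - real a\<close> is the slope. Two edges that meet at an inner abscissa
  and share an end or the slope lie on one line, and so are equal.\<close>

lemma on_edge_same_line:
  assumes "1 < N" "0 < x" "x < real L" "(a, b) \<noteq> (a', b')"
    and "on_edge N L a b x = on_edge N L a' b' x"
  shows "a \<noteq> a'" "b \<noteq> b'" "rung N b - real a \<noteq> rung N b' - real a'"
proof -
  have *: "(real L - x) * (real a - real a') = x * (rung N b' - rung N b)"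
    using assms(5) by (simp add: on_edge_eq_iff)
  show "a \<noteq> a'" "b \<noteq> b'"
    using * assms by (auto simp: rung_eq_iff)
  show "rung N b - real a \<noteq> rung N b' - real a'"
  proof
    assume "rung N b - real a = rung N b' - real a'"
    then have "rung N b' - rung N b = - (real a - real a')" by simp
    with * have "real L * (real a - real a') = 0" by (simp add: algebra_simps)
    then show False using \<open>a \<noteq> a'\<close> assms(2,3) by simp
  qed
qed

text \<open>The solutions \<open>x / L\<close> of
  \<open>(L - x) * (a - a') = x * (rung (Suc N) b' - rung (Suc N) b)\<close>, which are free of
  \<open>L\<close>. Quadruples that give no crossing only enlarge this finite set.\<close>

definition crossing_ratios :: "nat \<Rightarrow> real set" where
  "crossing_ratios N = (\<lambda>(a, a', b, b').
      (real a - real a') / ((real a - real a') + (rung (Suc N) b' - rung (Suc N) b)))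
    ` ({..<N} \<times> {..<N} \<times> {..<N} \<times> {..<N})"

lemma crossing_ratio:
  assumes "0 < x" "x < real L" "(a, b) \<noteq> (a', b')" "a < N" "a' < N" "b < N" "b' < N"
    and eq: "on_edge (Suc N) L a b x = on_edge (Suc N) L a' b' x"
  shows "x / real L \<in> crossing_ratios N"
proof -
  let ?r = "rung (Suc N)"
  define D where "D = (real a - real a') + (?r b' - ?r b)"
  have "1 < Suc N" using assms by simp
  from on_edge_same_line(3)[OF this assms(1-3) eq] have "D \<noteq> 0" by (simp add: D_def)
  moreover have "real L * (real a - real a') = x * D"
    using eq by (simp add: on_edge_eq_iff D_def algebra_simps)
  ultimately have "x / real L = (real a - real a') / D"
    using assms(1,2) by (simp add: field_simps)
  then show ?thesis
    unfolding crossing_ratios_def D_def using assms(4-7) by (intro image_eqI[of _ _ "(a, a', b, b')"]) auto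
qed

text \<open>Any \<open>L\<close> above the reciprocal of the smallest gap works. For the crossing
  ratios this is the origin of the path length.\<close>

lemma finite_set_separated:
  fixes T :: "real set"
  assumes "finite T"
  shows "\<exists>L\<ge>m. \<forall>t\<in>T. \<forall>t'\<in>T. t \<noteq> t' \<longrightarrow> 1 \<le> real L * \<bar>t - t'\<bar>"
proof -
  \<comment> \<open>The extra \<open>1\<close> keeps \<open>Min D\<close> meaningful and positive
    when \<open>T\<close> has fewer than two elements.\<close>
  define D where "D = insert 1 ((\<lambda>(t, t'). \<bar>t - t'\<bar>) ` (T \<times> T - Id))"
  have fin: "finite D" using assms by (auto simp: D_def)
  have "Min D \<in> D" using fin by (intro Min_in) (auto simp: D_def)
  then have pos: "0 < Min D" by (auto simp: D_def)
  obtain l :: nat where l: "1 / Min D \<le> real l" using real_arch_simple by blast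
  show ?thesis
  proof (intro exI[of _ "max m l"] conjI ballI impI)
    fix t t' assume t: "t \<in> T" "t' \<in> T" "t \<noteq> t'"
    then have "Min D \<le> \<bar>t - t'\<bar>"
      using fin by (intro Min_le) (force simp: D_def)+
    have "1 \<le> real l * Min D" using l pos by (simp add: field_simps)
    also have "\<dots> \<le> real (max m l) * \<bar>t - t'\<bar>"
      using \<open>Min D \<le> _\<close> pos by (intro mult_mono) auto
    finally show "1 \<le> real (max m l) * \<bar>t - t'\<bar>" .
  qed simp
qed

definition vtx_pos :: "nat \<Rightarrow> nat \<Rightarrow> nat \<Rightarrow> complex" where
  "vtx_pos N L = vtx_case (\<lambda>a b j. on_edge N L a b (real j))"

text \<open>The erased end has weight zero in \<open>on_edge\<close> at \<open>j = 0\<close> and at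
  \<open>j = L\<close>.\<close>

lemma vtx_pos_vtx: "j \<le> L \<Longrightarrow> vtx_pos N L (vtx L a b j) = on_edge N L a b (real j)"
  by (auto simp: vtx_pos_def vtx_case_vtx on_edge_def)

lemma on_edge_affine:
  "(1 - u) *\<^sub>R on_edge N L a b s + u *\<^sub>R on_edge N L a b t = on_edge N L a b ((1 - u) * s + u * t)"
  by (simp add: on_edge_def complex_eq_iff algebra_simps)

lemma closed_segment_on_edge:
  assumes "s \<le> t"
  shows "closed_segment (on_edge N L a b s) (on_edge N L a b t) = on_edge N L a b ` {s..t}"
proof -
  have "closed_segment (on_edge N L a b s) (on_edge N L a b t) =
      on_edge N L a b ` (\<lambda>u. (1 - u) *\<^sub>R s + u *\<^sub>R t) ` {0..1}"
    by (simp add: closed_segment_image_interval on_edge_affine image_image)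
  also have "\<dots> = on_edge N L a b ` {s..t}"
    using assms by (simp only: closed_segment_image_interval[symmetric] closed_segment_eq_real_ivl1)
  finally show ?thesis .
qed

lemma one_planar_subdivision:
  assumes R: "R \<subseteq> {..<N} \<times> {..<N}" and "0 < L"
    and sep: "\<And>t t'. t \<in> crossing_ratios N \<Longrightarrow> t' \<in> crossing_ratios N \<Longrightarrow> t \<noteq> t' \<Longrightarrow>
      1 \<le> real L * \<bar>t - t'\<bar>"
  shows "one_planar (subdivision R L)"
proof -
  let ?G = "subdivision R L" and ?E = "on_edge (Suc N) L"
  define pos where "pos = vtx_pos (Suc N) L"
  define \<gamma> where "\<gamma> = straight_edges pos"
  have pos: "pos (vtx L a b j) = ?E a b (real j)" if "j \<le> L" for a b j
    using that by (simp add: pos_def vtx_pos_vtx)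
  have bound: "a < N" "b < N" "1 < Suc N" if "(a, b) \<in> R" for a b
    using that R by auto
  have img: "path_image (\<gamma> {vtx L a b j, vtx L a b (Suc j)}) = ?E a b ` {real j..real (Suc j)}"
    if "j < L" for a b j
    using that by (simp add: \<gamma>_def path_image_straight_edges pos closed_segment_on_edge)
  \<comment> \<open>Used twice: vertices have distinct positions, and no edge runs through a foreign
    vertex.\<close>
  have at_vertex: "vtx L a' b' j = vtx L a b j \<and> real j = x"
    if "(a, b) \<in> R" "j \<le> L" "?E a' b' x = ?E a b (real j)" for a b a' b' j x
  proof -
    have "x = real j" using that(3) by (simp add: on_edge_eq_iff)
    with on_edge_at_integer[OF bound(3)[OF that(1)] that(2) assms(2), of a' b' a b] that(3)
    show ?thesis by blast
  qed

  have inj: "inj_on pos (pverts ?G)"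
  proof (rule inj_onI)
    fix u v assume "u \<in> pverts ?G" "v \<in> pverts ?G" and eq: "pos u = pos v"
    then obtain a b j a' b' j' where uv: "u = vtx L a b j" "v = vtx L a' b' j'"
      "(a, b) \<in> R" "(a', b') \<in> R" "j \<le> L" "j' \<le> L"
      by (blast elim: pverts_subdivisionE)
    then show "u = v"
      using eq at_vertex[of a' b' j' a b "real j"] by (auto simp: pos)
  qed

  have arcs: "arc (\<gamma> e)" "{pathstart (\<gamma> e), pathfinish (\<gamma> e)} = pos ` e"
    "path_image (\<gamma> e) \<inter> pos ` pverts ?G = pos ` e" if "e \<in> uedges ?G" for e
  proof -
    obtain a b j where e: "(a, b) \<in> R" "j < L" "e = {vtx L a b j, vtx L a b (Suc j)}"
      using \<open>e \<in> uedges ?G\<close> by (rule uedges_subdivisionE)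
    have "pos (vtx L a b j) \<noteq> pos (vtx L a b (Suc j))"
      using e by (simp add: pos on_edge_eq_iff)
    then show "arc (\<gamma> e)" by (simp add: e \<gamma>_def arc_straight_edges)
    show "{pathstart (\<gamma> e), pathfinish (\<gamma> e)} = pos ` e"
      unfolding e \<gamma>_def by (rule ends_straight_edges)
    have "p \<in> pos ` e" if p: "p \<in> path_image (\<gamma> e)" "p \<in> pos ` pverts ?G" for p
    proof -
      obtain a' b' j' where v: "(a', b') \<in> R" "j' \<le> L" "p = pos (vtx L a' b' j')"
        using p(2) by (blast elim: pverts_subdivisionE)
      obtain x where x: "real j \<le> x" "x \<le> real (Suc j)" "p = ?E a b x"
        using p(1) e(2) by (auto simp: e(3) img)
      have "?E a b x = ?E a' b' (real j')" using x v by (simp add: pos)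
      from at_vertex[OF v(1,2) this] have "vtx L a b j' = vtx L a' b' j'" "real j' = x" by auto
      moreover from this x have "j' = j \<or> j' = Suc j" by auto
      ultimately show ?thesis using v(3) e(3) by (metis image_eqI insertCI)
    qed
    moreover have "pos ` e \<subseteq> path_image (\<gamma> e)"
      using e(2) by (auto simp: e(3) img pos)
    moreover have "e \<subseteq> pverts ?G" using e by (auto intro: pverts_subdivisionI)
    ultimately show "path_image (\<gamma> e) \<inter> pos ` pverts ?G = pos ` e" by blast
  qed

  \<comment> \<open>A crossing lies strictly between consecutive integer abscissae on both edges, so
    both belong to the same strip \<open>j\<close>.\<close>
  have crossing: "\<exists>a' b' x. (a', b') \<in> R \<and> f = {vtx L a' b' j, vtx L a' b' (Suc j)} \<and>
      (a, b) \<noteq> (a', b') \<and> real j < x \<and> x < real (Suc j) \<and> p = ?E a b x \<and> p = ?E a' b' x"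
    if e: "(a, b) \<in> R" "j < L" "e = {vtx L a b j, vtx L a b (Suc j)}"
      and f: "f \<in> uedges ?G" "e \<noteq> f" and p: "p \<in> crossings pos \<gamma> e f" for a b j e f p
  proof -
    obtain a' b' j' where f': "(a', b') \<in> R" "j' < L" "f = {vtx L a' b' j', vtx L a' b' (Suc j')}"
      using f(1) by (rule uedges_subdivisionE)
    have p_e: "p \<in> ?E a b ` {real j..real (Suc j)}" "p \<notin> pos ` e"
      using p img[OF e(2)] by (auto simp: crossings_def e(3))
    have p_f: "p \<in> ?E a' b' ` {real j'..real (Suc j')}" "p \<notin> pos ` f"
      using p img[OF f'(2)] by (auto simp: crossings_def f'(3))
    obtain x where x: "real j \<le> x" "x \<le> real (Suc j)" "p = ?E a b x" using p_e(1) by auto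
    obtain x' where x': "real j' \<le> x'" "x' \<le> real (Suc j')" "p = ?E a' b' x'" using p_f(1) by auto
    have "x \<noteq> real j" "x \<noteq> real (Suc j)"
      using p_e(2) e(2) by (auto simp: e(3) pos x(3))
    moreover have "x' \<noteq> real j'" "x' \<noteq> real (Suc j')"
      using p_f(2) f'(2) by (auto simp: f'(3) pos x'(3))
    moreover have "x' = x" using x(3) x'(3) by (simp add: on_edge_eq_iff)
    ultimately have "real j < x" "x < real (Suc j)" "real j' < x" "x < real (Suc j')"
      using x x' by auto
    moreover from this have "j' = j" by linarith
    ultimately show ?thesis using f' f(2) e(3) x x' \<open>x' = x\<close> by blast
  qed

  have proper: "cross_properly_at (path_image (\<gamma> e)) (path_image (\<gamma> f)) p"
    if ef: "e \<in> uedges ?G" "f \<in> uedges ?G" "e \<noteq> f" "p \<in> crossings pos \<gamma> e f" for e f p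
  proof -
    obtain a b j where e: "(a, b) \<in> R" "j < L" "e = {vtx L a b j, vtx L a b (Suc j)}"
      using ef(1) by (rule uedges_subdivisionE)
    obtain a' b' x where f: "(a', b') \<in> R" "f = {vtx L a' b' j, vtx L a' b' (Suc j)}"
      "(a, b) \<noteq> (a', b')" "real j < x" "x < real (Suc j)" "p = ?E a b x" "p = ?E a' b' x"
      using crossing[OF e ef(2-4)] by blast
    have x: "0 < x" "x < real L" using f(4,5) e(2) by auto
    have on_open: "?E c d x \<in> open_segment (?E c d (real j)) (?E c d (real (Suc j)))" for c d
      using f(4,5) closed_segment_on_edge[of "real j" "real (Suc j)" "Suc N" L c d]
      by (auto simp: open_segment_def on_edge_eq_iff)
    \<comment> \<open>Both segments have horizontal extent one, so their determinant is the
      difference of the slopes.\<close>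
    have "rung (Suc N) b - real a \<noteq> rung (Suc N) b' - real a'"
      using on_edge_same_line(3)[OF bound(3)[OF e(1)] x f(3)] f(6,7) by simp
    then have "cross_properly_at (closed_segment (?E a b (real j)) (?E a b (real (Suc j))))
        (closed_segment (?E a' b' (real j)) (?E a' b' (real (Suc j)))) p"
    proof (intro cross_properly_at_segments)
      show "p \<in> open_segment (?E a b (real j)) (?E a b (real (Suc j)))"
        unfolding f(6) by (rule on_open)
      show "p \<in> open_segment (?E a' b' (real j)) (?E a' b' (real (Suc j)))"
        unfolding f(7) by (rule on_open)
    qed (simp add: on_edge_def algebra_simps)
    then show ?thesis
      using e(2) by (simp add: e(3) f(2) \<gamma>_def path_image_straight_edges pos)
  qed

  have nonadjacent: "crossings pos \<gamma> e f = {}"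
    if ef: "e \<in> uedges ?G" "f \<in> uedges ?G" "e \<noteq> f" "e \<inter> f \<noteq> {}" for e f
  proof (rule ccontr)
    assume "crossings pos \<gamma> e f \<noteq> {}"
    then obtain p where p: "p \<in> crossings pos \<gamma> e f" by blast
    obtain a b j where e: "(a, b) \<in> R" "j < L" "e = {vtx L a b j, vtx L a b (Suc j)}"
      using ef(1) by (rule uedges_subdivisionE)
    obtain a' b' x where f: "(a', b') \<in> R" "f = {vtx L a' b' j, vtx L a' b' (Suc j)}"
      "(a, b) \<noteq> (a', b')" "real j < x" "x < real (Suc j)" "p = ?E a b x" "p = ?E a' b' x"
      using crossing[OF e ef(2,3) p] by blast
    have x: "0 < x" "x < real L" using f(4,5) e(2) by auto
    \<comment> \<open>Paths whose ends differ on both sides have no vertex in common.\<close>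
    have "a \<noteq> a'" "b \<noteq> b'"
      using on_edge_same_line(1,2)[OF bound(3)[OF e(1)] x f(3)] f(6,7) by auto
    then show False
      using ef(4) e(2) by (auto simp: e(3) f(2) vtx_eq_iff)
  qed

  have at_most_one: "f = f' \<and> p = p'"
    if e: "e \<in> uedges ?G" and fp: "(f, p) \<in> edge_crossings ?G pos \<gamma> e"
      "(f', p') \<in> edge_crossings ?G pos \<gamma> e" for e f p f' p'
  proof -
    obtain a b j where e: "(a, b) \<in> R" "j < L" "e = {vtx L a b j, vtx L a b (Suc j)}"
      using e by (rule uedges_subdivisionE)
    obtain a1 b1 x1 where f: "(a1, b1) \<in> R" "f = {vtx L a1 b1 j, vtx L a1 b1 (Suc j)}"
      "(a, b) \<noteq> (a1, b1)" "real j < x1" "x1 < real (Suc j)" "p = ?E a b x1" "p = ?E a1 b1 x1"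
      using crossing[OF e] fp(1) unfolding edge_crossings_def by blast
    obtain a2 b2 x2 where f': "(a2, b2) \<in> R" "f' = {vtx L a2 b2 j, vtx L a2 b2 (Suc j)}"
      "(a, b) \<noteq> (a2, b2)" "real j < x2" "x2 < real (Suc j)" "p' = ?E a b x2" "p' = ?E a2 b2 x2"
      using crossing[OF e] fp(2) unfolding edge_crossings_def by blast
    have x: "0 < x1" "x1 < real L" "0 < x2" "x2 < real L" using f(4,5) f'(4,5) e(2) by auto
    have "x1 / real L \<in> crossing_ratios N"
      by (rule crossing_ratio[OF x(1,2) f(3)]) (use f(6,7) bound[OF e(1)] bound[OF f(1)] in auto)
    moreover have "x2 / real L \<in> crossing_ratios N"
      by (rule crossing_ratio[OF x(3,4) f'(3)]) (use f'(6,7) bound[OF e(1)] bound[OF f'(1)] in auto)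
    \<comment> \<open>Both crossings lie in the open strip between \<open>j\<close> and
      \<open>Suc j\<close>, so by \<open>sep\<close> their ratios cannot differ.\<close>
    moreover have "real L * \<bar>x1 / real L - x2 / real L\<bar> < 1"
    proof -
      have "real L * \<bar>x1 / real L - x2 / real L\<bar> = \<bar>real L * (x1 / real L - x2 / real L)\<bar>"
        by (simp add: abs_mult)
      also have "\<dots> = \<bar>x1 - x2\<bar>"
        using assms(2) by (simp add: right_diff_distrib)
      finally show ?thesis using f(4,5) f'(4,5) by linarith
    qed
    ultimately have "x1 / real L = x2 / real L" using sep by fastforce
    then have x12: "x1 = x2" using assms(2) by simp
    then have p: "p = p'" using f(6) f'(6) by simp
    have neq: "b \<noteq> b1" "b \<noteq> b2"
      using on_edge_same_line(2)[OF bound(3)[OF e(1)] x(1,2) f(3)] f(6,7)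
        on_edge_same_line(2)[OF bound(3)[OF e(1)] x(3,4) f'(3)] f'(6,7) by auto
    \<comment> \<open>Now \<open>e\<close>, \<open>f\<close> and \<open>f'\<close> pass through one
      point. The edge \<open>e\<close> differs from each of the others in its right end, so
      \<open>f\<close> and \<open>f'\<close> share theirs and therefore coincide.\<close>
    have "b = b1 \<or> b1 = b2 \<or> b = b2"
      by (rule on_edge_concurrent[OF x(1,2), of a N a1 a2 _ p])
        (use f f' p x12 bound[OF e(1)] bound[OF f(1)] bound[OF f'(1)] in auto)
    with neq have "b1 = b2" by simp
    moreover from this have "a1 = a2"
      using on_edge_same_line(2)[OF bound(3)[OF e(1)] x(1,2), of a1 b1 a2 b2] f(7) f'(7) p x12
      by auto
    ultimately show ?thesis using f(2) f'(2) p by simp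
  qed

  have edge_crossings: "finite (edge_crossings ?G pos \<gamma> e) \<and> card (edge_crossings ?G pos \<gamma> e) \<le> 1"
    if "e \<in> uedges ?G" for e
    using at_most_one[OF that] by (intro finite_card_le_1I) auto
  have crossings: "finite (crossings pos \<gamma> e f) \<and> card (crossings pos \<gamma> e f) \<le> 1"
    if "e \<in> uedges ?G" "f \<in> uedges ?G" "e \<noteq> f" for e f
    using at_most_one[OF that(1), of f _ f] that
    by (intro finite_card_le_1I) (auto simp: edge_crossings_def)
  have "drawing ?G pos \<gamma>"
    unfolding drawing_def using inj arcs proper by blast
  then have "simple_drawing ?G pos \<gamma>"
    unfolding simple_drawing_def using nonadjacent crossings by blast
  then show ?thesis
    unfolding one_planar_def using edge_crossings by blast
qed


section \<open>An incidence graph\<close>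

text \<open>
  Points \<open>(x, y)\<close> and lines \<open>(m, b)\<close> are incident if \<open>y + m * x + b = 0\<close> modulo \<open>n\<^sup>2\<close>.
  Restricting \<open>x\<close> and \<open>m\<close> to numbers below \<open>n\<close> makes up for the zero divisors.
\<close>

definition incidence :: "nat \<Rightarrow> (nat \<times> nat) set" where
  "incidence n = {(prod_encode (x, y), prod_encode (m, b)) | x y m b.
     x < n \<and> y < n\<^sup>2 \<and> m < n \<and> b < n\<^sup>2 \<and> n\<^sup>2 dvd y + m * x + b}"

lemma incidence_iff:
  "(prod_encode (x, y), prod_encode (m, b)) \<in> incidence n \<longleftrightarrow>
    x < n \<and> y < n\<^sup>2 \<and> m < n \<and> b < n\<^sup>2 \<and> n\<^sup>2 dvd y + m * x + b"
  by (auto simp: incidence_def)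

lemma incidenceE:
  assumes "(p, l) \<in> incidence n"
  obtains x y m b where "p = prod_encode (x, y)" "l = prod_encode (m, b)"
    "x < n" "y < n\<^sup>2" "m < n" "b < n\<^sup>2" "n\<^sup>2 dvd y + m * x + b"
  using assms by (auto simp: incidence_def)

text \<open>Duality of points and lines; it carries the degree bound from points over to
  lines.\<close>

lemma incidence_sym: "(p, l) \<in> incidence n \<Longrightarrow> (l, p) \<in> incidence n"
  by (erule incidenceE) (simp add: incidence_iff ac_simps)

lemma exists_complement_mod:
  fixes M s :: nat
  assumes "0 < M"
  shows "\<exists>b<M. M dvd s + b"
proof (intro exI conjI)
  \<comment> \<open>The outer \<open>mod\<close> covers the case \<open>s mod M = 0\<close>, where
    the difference is \<open>M\<close> itself.\<close>
  show "(M - s mod M) mod M < M" using assms by simp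
  have "(s + (M - s mod M) mod M) mod M = (s mod M + (M - s mod M)) mod M"
    by (simp add: mod_simps)
  also have "\<dots> = 0" using assms by (simp add: le_add_diff_inverse)
  finally show "M dvd s + (M - s mod M) mod M" by (rule mod_0_imp_dvd)
qed

lemma finite_incidence: "finite (incidence n)"
proof -
  let ?A = "prod_encode ` ({..<n} \<times> {..<n\<^sup>2})"
  have "incidence n \<subseteq> ?A \<times> ?A"
    by (auto elim!: incidenceE)
  then show ?thesis by (rule finite_subset) simp
qed

text \<open>For each of the \<open>n\<close> slopes \<open>m\<close>, the incidence equation can be
  solved for \<open>b\<close>.\<close>

lemma incidence_degree:
  assumes "p \<in> fst ` incidence n"
  shows "n \<le> card {l. (p, l) \<in> incidence n}"
proof -
  obtain x y where p: "p = prod_encode (x, y)" "x < n" "y < n\<^sup>2"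
    using assms by (auto elim!: incidenceE)
  have "\<exists>b<n\<^sup>2. n\<^sup>2 dvd (y + m * x) + b" for m
    using p by (intro exists_complement_mod) simp
  then obtain b where b: "\<And>m. b m < n\<^sup>2" "\<And>m. n\<^sup>2 dvd (y + m * x) + b m" by metis
  have "n = card ((\<lambda>m. prod_encode (m, b m)) ` {..<n})"
    by (subst card_image) (auto simp: inj_on_def)
  also have "\<dots> \<le> card {l. (p, l) \<in> incidence n}"
  proof (rule card_mono)
    have "{l. (p, l) \<in> incidence n} \<subseteq> snd ` incidence n" by force
    then show "finite {l. (p, l) \<in> incidence n}"
      using finite_incidence by (meson finite_imageI finite_subset)
  qed (use p b in \<open>auto simp: incidence_iff\<close>)
  finally show ?thesis .
qed

lemma dvd_diff_imp_eq:
  fixes M :: nat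
  assumes "int M dvd int u - int v" "u < M" "v < M"
  shows "u = v"
proof (rule ccontr)
  assume "u \<noteq> v"
  then have "\<bar>int M\<bar> \<le> \<bar>int u - int v\<bar>"
    using assms(1) by (intro dvd_imp_le_int) auto
  then show False using assms(2,3) by linarith
qed

text \<open>The alternating sum of the four incidences cancels all but
  \<open>(m - m') * (x - x')\<close>. This multiple of \<open>n\<^sup>2\<close> is smaller than
  \<open>n\<^sup>2\<close> in absolute value, so it is zero, and equality in one coordinate forces
  it in the other modulo \<open>n\<^sup>2\<close>.\<close>

lemma incidence_no_C4:
  assumes "(p, l) \<in> incidence n" "(p, l') \<in> incidence n"
    and "(p', l) \<in> incidence n" "(p', l') \<in> incidence n"
  shows "p = p' \<or> l = l'"
proof -
  obtain x y m b where 1: "p = prod_encode (x, y)" "l = prod_encode (m, b)"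
    using assms(1) by (rule incidenceE)
  obtain x' y' m' b' where 2: "p' = prod_encode (x', y')" "l' = prod_encode (m', b')"
    using assms(4) by (rule incidenceE)
  let ?M = "int (n\<^sup>2)"
  have lt: "x < n" "x' < n" "m < n" "m' < n" "y < n\<^sup>2" "y' < n\<^sup>2" "b < n\<^sup>2" "b' < n\<^sup>2"
    and dvd: "n\<^sup>2 dvd y + m * x + b" "n\<^sup>2 dvd y + m' * x + b'"
      "n\<^sup>2 dvd y' + m * x' + b" "n\<^sup>2 dvd y' + m' * x' + b'"
    using assms by (simp_all add: 1 2 incidence_iff)
  have d: "?M dvd int (y + m * x + b)" "?M dvd int (y + m' * x + b')"
      "?M dvd int (y' + m * x' + b)" "?M dvd int (y' + m' * x' + b')"
    using dvd by (simp_all only: int_dvd_int_iff)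
  have "?M dvd (int (y + m * x + b) - int (y + m' * x + b'))
      - (int (y' + m * x' + b) - int (y' + m' * x' + b'))"
    using d by (intro dvd_diff)
  also have "\<dots> = (int m - int m') * (int x - int x')"
    by (simp add: algebra_simps)
  finally have prod: "?M dvd (int m - int m') * (int x - int x')" .
  have "m = m' \<or> x = x'"
  proof (rule ccontr)
    assume "\<not> ?thesis"
    then have "\<bar>?M\<bar> \<le> \<bar>(int m - int m') * (int x - int x')\<bar>"
      using prod by (intro dvd_imp_le_int) auto
    also have "\<dots> < int n * int n"
      unfolding abs_mult using lt by (intro mult_strict_mono) auto
    finally show False by (simp add: power2_eq_square)
  qed
  then show ?thesis
  proof
    assume "m = m'"
    then have "?M dvd int b - int b'"
      using dvd_diff[OF d(1,2)] by simp
    then have "b = b'" using lt by (intro dvd_diff_imp_eq)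
    then show ?thesis using \<open>m = m'\<close> by (simp add: 1 2)
  next
    assume "x = x'"
    then have "?M dvd int y - int y'"
      using dvd_diff[OF d(1,3)] by simp
    then have "y = y'" using lt by (intro dvd_diff_imp_eq)
    then show ?thesis using \<open>x = x'\<close> by (simp add: 1 2)
  qed
qed

text \<open>The line of slope \<open>0\<close> through \<open>(x, y)\<close> leads to
  \<open>(0, y)\<close>. From \<open>(0, y + 1)\<close> the line of slope \<open>1\<close> leads to
  \<open>(1, y)\<close> and thus to \<open>(0, y)\<close>, so every incidence descends to height
  \<open>0\<close>. The coordinate \<open>1\<close> is available by
  \<open>2 \<le> n\<close>.\<close>

lemma incidence_connected:
  assumes n: "2 \<le> n" and "e \<in> incidence n" "e' \<in> incidence n"
  shows "(e, e') \<in> (share_end (incidence n))\<^sup>*"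
proof -
  let ?R = "incidence n" and ?S = "(share_end (incidence n))\<^sup>*"
  have sym: "(u, v) \<in> ?S \<Longrightarrow> (v, u) \<in> ?S" for u v
    by (rule symD[OF sym_rtrancl]) (auto simp: sym_def share_end_def)
  have same_point: "((p, l), (p, l')) \<in> ?S" if "(p, l) \<in> ?R" "(p, l') \<in> ?R" for p l l'
    using that by (intro r_into_rtrancl) (simp add: share_end_def)
  have same_line: "((p, l), (p', l)) \<in> ?S" if "(p, l) \<in> ?R" "(p', l) \<in> ?R" for p p' l
    using that by (intro r_into_rtrancl) (simp add: share_end_def)
  have "\<exists>b<n\<^sup>2. n\<^sup>2 dvd y + b" for y
    using n by (intro exists_complement_mod) simp
  then obtain b where b: "\<And>y. b y < n\<^sup>2" "\<And>y. n\<^sup>2 dvd y + b y" by metis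
  define E where "E = (\<lambda>y. (prod_encode (0, y), prod_encode (0, b y)))"
  have to_E: "((prod_encode (x, y), l), E y) \<in> ?S" if "(prod_encode (x, y), l) \<in> ?R" for x y l
  proof -
    have "(prod_encode (x, y), prod_encode (0, b y)) \<in> ?R"
      "(prod_encode (0, y), prod_encode (0, b y)) \<in> ?R"
      using that b n by (auto elim!: incidenceE simp: incidence_iff)
    then show ?thesis
      unfolding E_def using that same_point same_line by (meson rtrancl_trans)
  qed
  have to_0: "(E y, E 0) \<in> ?S" if "y < n\<^sup>2" for y
    using that
  proof (induction y)
    case (Suc y)
    let ?l = "prod_encode (1, b (Suc y))"
    have R: "(prod_encode (0, Suc y), ?l) \<in> ?R" "(prod_encode (1, y), ?l) \<in> ?R"
      "E (Suc y) \<in> ?R"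
      using b[of "Suc y"] n Suc.prems by (auto simp: incidence_iff E_def)
    have "(E (Suc y), (prod_encode (0, Suc y), ?l)) \<in> ?S"
      using same_point R(1,3) by (simp add: E_def)
    also have "((prod_encode (0, Suc y), ?l), (prod_encode (1, y), ?l)) \<in> ?S"
      using same_line R by blast
    also have "((prod_encode (1, y), ?l), E y) \<in> ?S"
      using to_E R(2) by blast
    also have "(E y, E 0) \<in> ?S" using Suc by simp
    finally show ?case .
  qed simp
  have "(d, E 0) \<in> ?S" if d: "d \<in> ?R" for d
  proof -
    obtain x y l where "d = (prod_encode (x, y), l)" "y < n\<^sup>2"
      using d by (cases d) (auto elim: incidenceE)
    then show ?thesis using to_E to_0 d by (meson rtrancl_trans)
  qed
  with sym assms(2,3) show ?thesis by (meson rtrancl_trans)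
qed

theorem theorem1:
  fixes c :: nat
  shows "\<exists>G :: nat pair_pre_digraph.
           pair_graph G \<and> Digraph_Component.connected (with_proj G) \<and> one_planar G \<and>
           cop_number G \<ge> c"
proof -
  define n where "n = max c 2"
  have n: "c \<le> n" "2 \<le> n" by (auto simp: n_def)
  let ?R = "incidence n"
  have "(prod_encode (0, 0), prod_encode (0, 0)) \<in> ?R" using n by (simp add: incidence_iff)
  then have ne: "?R \<noteq> {}" by blast
  have "finite (fst ` ?R \<union> snd ` ?R)" using finite_incidence by blast
  then obtain N where "\<forall>v \<in> fst ` ?R \<union> snd ` ?R. v < N"
    using finite_nat_set_iff_bounded by blast
  then have N: "?R \<subseteq> {..<N} \<times> {..<N}" by force
  have "finite (crossing_ratios N)" by (simp add: crossing_ratios_def)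
  \<comment> \<open>The ratios depend on \<open>N\<close> alone, which is why \<open>L\<close> can
    be fixed last.\<close>
  from finite_set_separated[OF this, of 2] obtain L where L: "2 \<le> L"
    "\<And>t t'. t \<in> crossing_ratios N \<Longrightarrow> t' \<in> crossing_ratios N \<Longrightarrow> t \<noteq> t' \<Longrightarrow>
      1 \<le> real L * \<bar>t - t'\<bar>" by blast
  let ?G = "subdivision ?R L"
  have graph: "pair_graph ?G" by (rule pair_graph_subdivision[OF finite_incidence])
  have connected: "Digraph_Component.connected (with_proj ?G)"
    using finite_incidence ne incidence_connected[OF n(2)] by (rule connected_subdivision)
  have planar: "one_planar ?G"
    using N _ L(2) by (rule one_planar_subdivision) (use L(1) in simp)
  have lower: "\<not> cops_win ?G k" if "k < c" for k
  proof (rule not_cops_win_subdivision[OF finite_incidence L(1) incidence_no_C4 _ _ ne])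
    have k: "k < n" using that n(1) by simp
    show "k < card {l. (p, l) \<in> ?R}" if "p \<in> fst ` ?R" for p
      using incidence_degree[OF that] k by simp
    show "k < card {p. (p, l) \<in> ?R}" if "l \<in> snd ` ?R" for l
    proof -
      have "{p. (p, l) \<in> ?R} = {p. (l, p) \<in> ?R}" and "l \<in> fst ` ?R"
        using that incidence_sym by force+
      then show ?thesis using incidence_degree[of l n] k by simp
    qed
  qed
  interpret pair_graph ?G by (rule graph)
  \<comment> \<open>The \<open>LEAST\<close> is attained because a cop on every vertex wins; so
    \<open>cop_number\<close> is itself a winning number and cannot be below
    \<open>c\<close>.\<close>
  have "cops_win ?G (cop_number ?G)"
    unfolding cop_number_def using cops_win_card[OF pair_finite_verts] by (rule LeastI)
  then have "c \<le> cop_number ?G" using lower not_le by blast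
  with graph connected planar show ?thesis by blast
qed

end
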